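(* Let $n\ge 1$ be a natural number and let $(\mathcal P,\mathcal L)$ be a symmetric $((n^2+n+3)_{n+1})$ configuration (that is, of deficiency $k=3$). Suppose that its lines are partitioned into $m$ cycles of lines in which consecutive lines are non-intersecting. Then either the configuration is (isomorphic to) configuration $9.1$, or $m$ is odd.
   Context: A symmetric $(v_r)$ configuration is a pair $(\mathcal P,\mathcal L)$ where $\mathcal P$ is a finite set of $v$ points, $v\ge 3$, and $\mathcal L$ is a set of $v$ lines, each line being a subset of $\mathcal P$, such that each line contains exactly $r$ points, each point lies on exactly $r$ lines, and any two distinct points lie together on at most one line (equivalently, any two distinct lines share at most one point). Configurations are assumed connected: $\mathcal P$ cannot be split into two nonempty parts such that every line lies inside one of the parts. A $((n^2+n+k)_{n+1})$ configuration is a symmetric $(v_r)$ configuration with $v=n^2+n+k$ and $r=n+1$; $k$ is called its deficiency. Two lines are parallel (non-intersecting) if they have no point in common. When $k=3$, every line is non-intersecting with exactly two other lines, so the graph whose vertices are the lines, with two distinct lines adjacent when they are non-intersecting, is $2$-regular and hence a disjoint union of cycles (each of length at least $3$). The partition of the lines into $m$ cycles is this decomposition; $m$ is the number of connected components of the graph. Configuration $9.1$ is the $(9_3)$ configuration with points $0,1,\dots,8$ and lines $\{0,1,2\},\{3,4,5\},\{6,7,8\},\{0,3,6\},\{0,4,7\},\{1,3,7\},\{1,5,8\},\{2,4,8\},\{2,5,6\}$. Two configurations are isomorphic if there is a bijection between their point sets that maps the set of lines of one onto the set of lines of the other. *)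

theory Defs
  imports "Graph_Theory.Digraph_Component"
begin

locale symmetric_configuration =
  fixes P :: "'a set" and L :: "'a set set" and v r :: nat
  assumes finite_points: "finite P"
    and card_points: "card P = v"
    and three_le: "3 \<le> v"
    and card_lines: "card L = v"
    and line_subset: "\<And>l. l \<in> L \<Longrightarrow> l \<subseteq> P"
    and card_line: "\<And>l. l \<in> L \<Longrightarrow> card l = r"
    and card_lines_through: "\<And>p. p \<in> P \<Longrightarrow> card {l \<in> L. p \<in> l} = r"
    and line_unique: "\<And>p q l l'. \<lbrakk>p \<in> P; q \<in> P; p \<noteq> q; l \<in> L; l' \<in> L;
      p \<in> l; q \<in> l; p \<in> l'; q \<in> l'\<rbrakk> \<Longrightarrow> l = l'"
    and connected_configuration: "\<not> (\<exists>A B. A \<noteq> {} \<and> B \<noteq> {} \<and> A \<union> B = P \<and> A \<inter> B = {} \<and>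
      (\<forall>l\<in>L. l \<subseteq> A \<or> l \<subseteq> B))"

text \<open>The undirected graph on the lines, encoded as a symmetric digraph.\<close>

definition parallel_graph :: "'a set set \<Rightarrow> 'a set pair_pre_digraph" where
  "parallel_graph L = \<lparr>pverts = L,
     parcs = {(l, l'). l \<in> L \<and> l' \<in> L \<and> l \<noteq> l' \<and> l \<inter> l' = {}}\<rparr>"

text \<open>In a symmetric digraph the strongly connected components are the connected components of
  the undirected graph. For a configuration of deficiency \<open>3\<close> the graph is \<open>2\<close>-regular, so its
  components are the cycles into which the lines are partitioned.\<close>

definition parallel_cycles :: "'a set set \<Rightarrow> ('a set, 'a set \<times> 'a set) pre_digraph set" where
  "parallel_cycles L = pre_digraph.sccs (with_proj (parallel_graph L))"

definition configuration_iso :: "'a set \<Rightarrow> 'a set set \<Rightarrow> 'b set \<Rightarrow> 'b set set \<Rightarrow> bool" where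
  "configuration_iso P L P' L' \<longleftrightarrow> (\<exists>f. bij_betw f P P' \<and> (\<lambda>l. f ` l) ` L = L')"

definition points_9_1 :: "nat set" where
  "points_9_1 = {0..8}"

definition lines_9_1 :: "nat set set" where
  "lines_9_1 = {{0,1,2}, {3,4,5}, {6,7,8}, {0,3,6}, {0,4,7}, {1,3,7}, {1,5,8}, {2,4,8}, {2,5,6}}"

end

theory Submission
  imports Defs "HOL-Combinatorics.Cycles" "Jordan_Normal_Form.Determinant"
begin

text \<open>Let \<open>A\<close> be the incidence matrix and let \<open>S\<close> be the matrix of a permutation \<open>s\<close> of the lines
  that rotates each of the \<open>m\<close> cycles. Then \<open>A A\<^sup>T = n I + J - S - S\<^sup>T\<close>. For \<open>n \<ge> 3\<close> let
  \<open>a > 1 > b\<close> be the roots of \<open>X\<^sup>2 - n X + 1\<close>, so that \<open>n I - S - S\<^sup>T = a (I - b S) (I - b S)\<^sup>T\<close> and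
  \<open>(n - 2) det(A)\<^sup>2 = (n + 1)\<^sup>2 a\<^sup>v det(I - b S)\<^sup>2\<close>. As \<open>v = 2 k - 1\<close> is odd and
  \<open>a (n - 2) = (a - 1)\<^sup>2\<close>, taking square roots gives \<open>a\<^sup>k det(I - b S) = (a - 1) y\<close> with \<open>y\<close>
  rational. Since \<open>a\<close> is irrational, this can be conjugated, and
  \<open>det(I - a S) = - a\<^sup>v sign(s) det(I - b S)\<close> then forces \<open>sign(s) = 1\<close>. But \<open>s\<close> has sign
  \<open>(-1)\<^sup>v\<^sup>-\<^sup>m\<close>, so \<open>m\<close> is odd.

  For \<open>n = 2\<close> every cycle of length \<open>c\<close> has exactly \<open>c/3\<close> lines through each point, so an even \<open>m\<close>
  means one triangle and one hexagon. The points are then the nine pairs of non-consecutive lines of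
  the hexagon, and the triangle must be the unique 1-factorization of the complement of a
  6-cycle. For \<open>n = 1\<close> there are only five lines, hence a single cycle.\<close>

section \<open>Two-regular graphs and rotations of their cycles\<close>

text \<open>Prescribing the whole neighbourhood in \<open>V\<close> makes such a list an entire
  component, not merely a closed path. In the predecessor index \<open>length cs\<close> is added
  before subtracting, so that index 0 wraps to the last one.\<close>

definition is_cycle :: "('a \<Rightarrow> 'a \<Rightarrow> bool) \<Rightarrow> 'a set \<Rightarrow> 'a list \<Rightarrow> bool" where
  "is_cycle adj V cs \<longleftrightarrow> distinct cs \<and> 3 \<le> length cs \<and> set cs \<subseteq> V \<and>
     (\<forall>i < length cs. {y \<in> V. adj (cs ! i) y} =
        {cs ! (Suc i mod length cs), cs ! ((i + length cs - 1) mod length cs)})"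

text \<open>Take a longest path. Maximality puts both neighbours of its first vertex on the path,
  and the degree bound allows one that is not the second vertex only at the far end, so the path
  closes up.\<close>

lemma two_regular_has_cycle:
  assumes fin: "finite V" and ne: "V \<noteq> {}"
    and sym: "\<And>x y. adj x y \<Longrightarrow> adj y x" and irr: "\<And>x. \<not> adj x x"
    and deg: "\<And>x. x \<in> V \<Longrightarrow> card {y \<in> V. adj x y} = 2"
  shows "\<exists>cs. is_cycle adj V cs"
proof -
  define path where "path xs \<longleftrightarrow> distinct xs \<and> set xs \<subseteq> V \<and>
    (\<forall>i. Suc i < length xs \<longrightarrow> adj (xs ! i) (xs ! Suc i))" for xs
  obtain x0 where x0: "x0 \<in> V" using ne by auto
  have p1: "path [x0]" using x0 by (simp add: path_def)
  have bound: "length xs \<le> card V" if "path xs" for xs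
    using that fin unfolding path_def by (metis card_mono distinct_card)
  obtain xs where xs: "path xs" and xsmax: "\<And>ys. path ys \<Longrightarrow> length ys \<le> length xs"
    using ex_has_greatest_nat[of path "[x0]" length "Suc (card V)"] p1 bound less_Suc_eq_le by blast
  define c where "c = length xs"
  have c0: "0 < c" using xsmax[OF p1] by (auto simp: c_def)
  have dist: "distinct xs" and sub: "set xs \<subseteq> V" 
    and step: "\<And>i. Suc i < c \<Longrightarrow> adj (xs ! i) (xs ! Suc i)"
    using xs by (auto simp: path_def c_def)
  have inV: "xs ! i \<in> V" if "i < c" for i using sub that by (auto simp: c_def)
  have neq: "xs ! i \<noteq> xs ! j" if "i < c" "j < c" "i \<noteq> j" for i j
    using dist that by (simp add: nth_eq_iff_index_eq c_def)
  \<comment> \<open>A neighbour off the path could be prepended to give a longer path.\<close>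
  have closed: "y \<in> set xs" if "y \<in> V" "adj (xs ! 0) y" for y
  proof (rule ccontr)
    assume "y \<notin> set xs"
    then have "path (y # xs)"
      using dist sub that step sym unfolding path_def by (auto simp: nth_Cons c_def split: nat.split)
    from xsmax[OF this] show False by simp
  qed
  have three: False if "x \<in> V" "{a, b, d} \<subseteq> {y \<in> V. adj x y}" "a \<noteq> b" "a \<noteq> d" "b \<noteq> d" for x a b d
  proof -
    have "card {a, b, d} \<le> card {y \<in> V. adj x y}" by (rule card_mono) (use fin that in auto)
    then show False using deg[OF that(1)] that by simp
  qed
  have "card {y \<in> V. adj (xs ! 0) y} = 2" using deg inV c0 by blast
  then obtain a b where ab: "{y \<in> V. adj (xs ! 0) y} = {a, b}" "a \<noteq> b" by (meson card_2_iff)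
  then have "a \<in> set xs" "b \<in> set xs" using closed by blast+
  then obtain i j where ij: "i < c" "j < c" "a = xs ! i" "b = xs ! j"
    unfolding in_set_conv_nth c_def by blast
  then have "i \<noteq> 0" "j \<noteq> 0" "i \<noteq> j" using ab irr by (metis (mono_tags) insertCI mem_Collect_eq)+
  moreover have "adj (xs ! 0) (xs ! i)" "adj (xs ! 0) (xs ! j)" using ab ij by auto
  ultimately obtain k where k: "2 \<le> k" "k < c" "adj (xs ! 0) (xs ! k)"
    using ij that[of i] that[of j] by (cases "2 \<le> i") simp_all
  \<comment> \<open>An inner \<open>xs ! k\<close> would have three neighbours, its two path
    neighbours and \<open>xs ! 0\<close>; they are distinct because
    \<open>2 \<le> k\<close>.\<close>
  have "k = c - 1"
  proof (rule ccontr)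
    assume "k \<noteq> c - 1"
    then have "Suc k < c" using k by simp
    moreover have "adj (xs ! k) (xs ! (k - 1))" using step[of "k - 1"] k sym by simp
    ultimately show False
      using three[of "xs ! k" "xs ! 0" "xs ! (k - 1)" "xs ! Suc k"] k step[of k] sym[OF k(3)]
      by (simp add: inV neq)
  qed
  then have c3: "3 \<le> c" and wrap: "adj (xs ! 0) (xs ! (c - 1))" using k by auto
  have succ: "adj (xs ! i) (xs ! (Suc i mod c))" if "i < c" for i
    using step[of i] that sym[OF wrap] by (cases "Suc i = c") auto
  have pred: "adj (xs ! i) (xs ! ((i + c - 1) mod c))" if "i < c" for i
  proof (cases i)
    case 0 then show ?thesis using wrap c3 by simp
  next
    case (Suc i') then show ?thesis using step[of i'] that sym by (simp add: Suc)
  qed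
  have "{y \<in> V. adj (xs ! i) y} = {xs ! (Suc i mod c), xs ! ((i + c - 1) mod c)}" if "i < c" for i
  proof -
    \<comment> \<open>From length 3 on, successor and predecessor differ, so together they exhaust
      the degree 2.\<close>
    have "Suc i mod c \<noteq> (i + c - 1) mod c"
      using that c3 by (cases "i = 0"; cases "Suc i = c") (auto simp: mod_if)
    then have "xs ! (Suc i mod c) \<noteq> xs ! ((i + c - 1) mod c)" using c3 by (intro neq) auto
    moreover have "{xs ! (Suc i mod c), xs ! ((i + c - 1) mod c)} \<subseteq> {y \<in> V. adj (xs ! i) y}"
      using succ[OF that] pred[OF that] c3 inV by auto
    ultimately have "{xs ! (Suc i mod c), xs ! ((i + c - 1) mod c)} = {y \<in> V. adj (xs ! i) y}"
      using deg[OF inV[OF that]] fin by (intro card_subset_eq) auto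
    then show ?thesis ..
  qed
  then show ?thesis
    using dist sub c3 unfolding is_cycle_def c_def by blast
qed

lemma is_cycle_closed:
  assumes "is_cycle adj V cs" "x \<in> set cs" "y \<in> V" "adj x y" shows "y \<in> set cs"
proof -
  obtain i where i: "i < length cs" "x = cs ! i" using assms(2) by (metis in_set_conv_nth)
  then have "y \<in> {cs ! (Suc i mod length cs), cs ! ((i + length cs - 1) mod length cs)}"
    using assms unfolding is_cycle_def by blast
  moreover have "0 < length cs" using i by auto
  ultimately show ?thesis by auto
qed

text \<open>A cycle is closed under adjacency, so by symmetry its removal leaves all other
  neighbourhoods intact and the rest is again two-regular.\<close>

lemma two_regular_cycle_partition:
  assumes "finite V"
    and sym: "\<And>x y. adj x y \<Longrightarrow> adj y x" and irr: "\<And>x. \<not> adj x x"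
    and "\<And>x. x \<in> V \<Longrightarrow> card {y \<in> V. adj x y} = 2"
  shows "\<exists>css. distinct (concat css) \<and> set (concat css) = V \<and> (\<forall>cs \<in> set css. is_cycle adj V cs)"
  using assms(1,4)
proof (induction "card V" arbitrary: V rule: less_induct)
  case (less V)
  show ?case
  proof (cases "V = {}")
    case True then show ?thesis by (intro exI[of _ "[]"]) simp
  next
    case False
    obtain cs where cs: "is_cycle adj V cs"
      using two_regular_has_cycle[OF less.prems(1) False sym irr less.prems(2)] by blast
    define W where "W = V - set cs"
    have csV: "set cs \<subseteq> V" and csne: "cs \<noteq> []" using cs by (auto simp: is_cycle_def)
    have nbr: "{y \<in> V. adj x y} = {y \<in> W. adj x y}" if "x \<in> W" for x
      using that is_cycle_closed[OF cs] sym by (auto simp: W_def)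
    have W: "finite W" using less.prems(1) by (simp add: W_def)
    have degW: "card {y \<in> W. adj x y} = 2" if "x \<in> W" for x
      using less.prems(2)[of x] nbr[OF that] that by (simp add: W_def)
    have "card W < card V"
      unfolding W_def using csV csne less.prems(1)
      by (intro psubset_card_mono) (auto simp: neq_Nil_conv)
    from less.hyps[OF this W degW] obtain css where css: "distinct (concat css)" "set (concat css) = W"
      "\<forall>ds \<in> set css. is_cycle adj W ds"
      by blast
    have "is_cycle adj V ds" if "ds \<in> set css" for ds
    proof -
      have ds: "is_cycle adj W ds" using css that by blast
      then have sub: "set ds \<subseteq> W" by (simp add: is_cycle_def)
      then have "{y \<in> V. adj (ds ! i) y} = {y \<in> W. adj (ds ! i) y}" if "i < length ds" for i
        using nbr that by (meson nth_mem subsetD)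
      then show ?thesis using ds sub unfolding is_cycle_def W_def by auto
    qed
    then show ?thesis
      using cs css csV by (intro exI[of _ "cs # css"]) (auto simp: W_def is_cycle_def)
  qed
qed

section \<open>The permutation rotating all cycles, and its sign\<close>

definition cycles_perm :: "'a list list \<Rightarrow> 'a \<Rightarrow> 'a" where
  "cycles_perm css = foldr (\<lambda>cs f. cycle_of_list cs \<circ> f) css id"

lemma cycles_perm_simps [simp]:
  "cycles_perm [] = id" "cycles_perm (cs # css) = cycle_of_list cs \<circ> cycles_perm css"
  by (simp_all add: cycles_perm_def)

lemma cycle_of_list_nth:
  assumes "distinct cs" "i < length cs"
  shows "cycle_of_list cs (cs ! i) = cs ! (Suc i mod length cs)"
proof -
  have "map (cycle_of_list cs ^^ 1) cs = rotate 1 cs" by (rule cyclic_rotation[OF assms(1)])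
  then have "map (cycle_of_list cs) cs ! i = rotate1 cs ! i" by simp
  then show ?thesis using assms by (simp add: nth_rotate1)
qed

lemma cycles_perm_permutes: "cycles_perm css permutes set (concat css)"
proof (induction css)
  case (Cons cs css)
  have "cycle_of_list cs permutes set (concat (cs # css))"
    by (rule permutes_subset[OF cycle_permutes]) auto
  moreover have "cycles_perm css permutes set (concat (cs # css))"
    by (rule permutes_subset[OF Cons.IH]) auto
  ultimately show ?case by (simp only: cycles_perm_simps permutes_compose)
qed (simp add: permutes_id del: id_apply)

text \<open>By disjointness the factors other than that of \<open>cs\<close> fix both
  \<open>cs ! i\<close> and its successor, so only one factor acts.\<close>

lemma cycles_perm_nth:
  assumes "distinct (concat css)" "cs \<in> set css" "i < length cs"
  shows "cycles_perm css (cs ! i) = cs ! (Suc i mod length cs)"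
  using assms
proof (induction css)
  case (Cons ds css)
  have d: "distinct cs" using Cons.prems by (metis distinct_concat_iff)
  have len: "Suc i mod length cs < length cs" using Cons.prems(3) by (intro mod_less_divisor) auto
  show ?case
  proof (cases "cs \<in> set css")
    case True
    then have *: "cycles_perm css (cs ! i) = cs ! (Suc i mod length cs)" using Cons by auto
    have "cs ! (Suc i mod length cs) \<notin> set ds"
      using True Cons.prems nth_mem[OF len] by auto
    then show ?thesis using * by (simp add: id_outside_supp)
  next
    case False
    then have [simp]: "ds = cs" using Cons.prems by auto
    have "cs ! i \<notin> set (concat css)"
      using Cons.prems nth_mem[OF Cons.prems(3)] by (metis \<open>ds = cs\<close> concat.simps(2) disjoint_iff distinct_append)
    then have "cycles_perm css (cs ! i) = cs ! i"
      using cycles_perm_permutes by (metis permutes_not_in)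
    then show ?thesis using cycle_of_list_nth[OF d Cons.prems(3)] by simp
  qed
qed simp

text \<open>A cycle of length \<open>c\<close> is a product of \<open>c - 1\<close> transpositions;
  the exponent \<open>c + 1\<close> has the same parity and avoids truncated subtraction.\<close>

lemma sign_cycle_of_list:
  "distinct cs \<Longrightarrow> cs \<noteq> [] \<Longrightarrow> sign (cycle_of_list cs) = (- 1) ^ (length cs + 1)"
proof (induction cs rule: cycle_of_list.induct)
  case (1 i j cs)
  then show ?case
    by (simp add: sign_compose permutation_swap_id permutation_of_cycle sign_swap_id del: o_apply)
qed auto

lemma sign_cycles_perm:
  "distinct (concat css) \<Longrightarrow> [] \<notin> set css \<Longrightarrow>
    sign (cycles_perm css) = (- 1) ^ (length (concat css) + length css)"
proof (induction css)
  case (Cons cs css)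
  have "permutation (cycles_perm css)"
    using cycles_perm_permutes by (metis List.finite_set permutation_permutes)
  then have "sign (cycles_perm (cs # css)) = sign (cycle_of_list cs) * sign (cycles_perm css)"
    by (simp add: sign_compose permutation_of_cycle)
  with Cons show ?case
    by (auto simp: sign_cycle_of_list power_add simp del: o_apply cycles_perm_simps)
qed simp

text \<open>The two neighbours of \<open>x\<close> are its image and its preimage under the
  rotation; injectivity turns the preimage into the second disjunct.\<close>

lemma is_cycle_adj_iff:
  assumes css: "distinct (concat css)" "set (concat css) = V" "\<forall>cs \<in> set css. is_cycle adj V cs"
    and xy: "x \<in> V" "y \<in> V"
  shows "adj x y \<longleftrightarrow> y = cycles_perm css x \<or> x = cycles_perm css y"
proof -
  let ?s = "cycles_perm css"
  obtain cs where cs: "cs \<in> set css" "x \<in> set cs" using css xy by auto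
  then obtain i where i: "i < length cs" "x = cs ! i" by (metis in_set_conv_nth)
  define c where "c = length cs"
  have c: "0 < c" "i < c" using i by (auto simp: c_def)
  have sx: "?s x = cs ! (Suc i mod c)" using cycles_perm_nth[OF css(1) cs(1)] i by (simp add: c_def)
  have "?s (cs ! ((i + c - 1) mod c)) = cs ! (Suc ((i + c - 1) mod c) mod c)"
    using cycles_perm_nth[OF css(1) cs(1)] c by (simp add: c_def)
  also have "Suc ((i + c - 1) mod c) mod c = Suc (i + c - 1) mod c" by (rule mod_Suc_eq)
  also have "\<dots> = i" using c by simp
  finally have px: "?s (cs ! ((i + c - 1) mod c)) = x" using i by simp
  have inj: "inj ?s" using cycles_perm_permutes by (rule permutes_inj)
  have "{y \<in> V. adj x y} = {?s x, cs ! ((i + c - 1) mod c)}"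
    using css(3) cs(1) i(1) unfolding is_cycle_def c_def i(2) sx[unfolded i(2) c_def] by blast
  then have "adj x y \<longleftrightarrow> y = ?s x \<or> y = cs ! ((i + c - 1) mod c)" using xy by blast
  also have "y = cs ! ((i + c - 1) mod c) \<longleftrightarrow> x = ?s y"
    unfolding px[symmetric] inj_eq[OF inj] by blast
  finally show ?thesis .
qed

text \<open>Without fixed points and 2-cycles the supports of \<open>I\<close>, \<open>S\<close> and
  \<open>S\<^sup>T\<close> are pairwise disjoint, which the entries of the Gram matrix rely
  on.\<close>

lemma cycles_perm_moves:
  assumes css: "distinct (concat css)" "\<forall>cs \<in> set css. 3 \<le> length cs"
    and x: "x \<in> set (concat css)"
  shows "cycles_perm css x \<noteq> x" "cycles_perm css (cycles_perm css x) \<noteq> x"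
proof -
  obtain cs where cs: "cs \<in> set css" "x \<in> set cs" using css x by auto
  then obtain i where i: "i < length cs" "x = cs ! i" by (metis in_set_conv_nth)
  define c where "c = length cs"
  have c: "3 \<le> c" "i < c" using i cs css by (auto simp: c_def)
  have d: "distinct cs" using css cs by (metis distinct_concat_iff)
  have sx: "cycles_perm css x = cs ! (Suc i mod c)"
    using cycles_perm_nth[OF css(1) cs(1)] i by (simp add: c_def)
  have "cycles_perm css (cs ! (Suc i mod c)) = cs ! (Suc (Suc i mod c) mod c)"
    using cycles_perm_nth[OF css(1) cs(1), of "Suc i mod c"] c
    by (metis c_def mod_less_divisor less_le_trans zero_less_numeral)
  then have ssx: "cycles_perm css (cycles_perm css x) = cs ! (Suc (Suc i) mod c)"
    unfolding sx by (simp add: mod_Suc_eq)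
  have "Suc i mod c \<noteq> i" "Suc (Suc i) mod c \<noteq> i"
    using c by (cases "Suc i = c"; simp add: mod_if)+
  then have "cs ! (Suc i mod c) \<noteq> x" "cs ! (Suc (Suc i) mod c) \<noteq> x"
    unfolding i(2) using nth_eq_iff_index_eq[OF d, folded c_def] c(2) by simp_all
  then show "cycles_perm css x \<noteq> x" "cycles_perm css (cycles_perm css x) \<noteq> x"
    using sx ssx by simp_all
qed

text \<open>Consecutive vertices of a list are joined and arcs can be reversed, so each list is
  strongly connected; closure confines reachability to it.\<close>

lemma card_sccs_sym_digraph:
  assumes G: "sym_digraph G" and css: "set (concat css) = verts G" "distinct (concat css)" "[] \<notin> set css"
    and step: "\<And>cs i. cs \<in> set css \<Longrightarrow> Suc i < length cs \<Longrightarrow> cs ! i \<rightarrow>\<^bsub>G\<^esub> cs ! Suc i"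
    and closed: "\<And>cs x y. cs \<in> set css \<Longrightarrow> x \<in> set cs \<Longrightarrow> x \<rightarrow>\<^bsub>G\<^esub> y \<Longrightarrow> y \<in> set cs"
  shows "card (pre_digraph.sccs G) = length css"
proof -
  interpret sym_digraph G by fact
  have from0: "cs ! 0 \<rightarrow>\<^sup>*\<^bsub>G\<^esub> cs ! i" if "cs \<in> set css" "i < length cs" for cs i
    using that(2)
  proof (induction i)
    case 0
    then have "cs ! 0 \<in> verts G" using that(1) css(1) by (metis UN_I nth_mem set_concat)
    then show ?case by simp
  next
    case (Suc i)
    then have "cs ! 0 \<rightarrow>\<^sup>*\<^bsub>G\<^esub> cs ! i" by simp
    also have "cs ! i \<rightarrow>\<^bsub>G\<^esub> cs ! Suc i" using step[OF that(1)] Suc by blast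
    finally show ?case .
  qed
  have conn: "x \<rightarrow>\<^sup>*\<^bsub>G\<^esub> y" if "cs \<in> set css" "x \<in> set cs" "y \<in> set cs" for cs x y
  proof -
    have "cs ! 0 \<rightarrow>\<^sup>*\<^bsub>G\<^esub> x" "cs ! 0 \<rightarrow>\<^sup>*\<^bsub>G\<^esub> y"
      using from0[OF that(1)] that(2,3) by (metis in_set_conv_nth)+
    then show ?thesis using symmetric_reachable[OF sym_arcs] reachable_trans by blast
  qed
  have stay: "y \<in> set cs" if "x \<rightarrow>\<^sup>*\<^bsub>G\<^esub> y" "cs \<in> set css" "x \<in> set cs" for cs x y
    using that by (induction rule: reachable_induct) (auto intro: closed)
  have scc: "scc_of x = set cs" if "cs \<in> set css" "x \<in> set cs" for cs x
    using that conn stay unfolding scc_of_def by blast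
  have "sccs_verts = scc_of ` verts G" by (rule sccs_verts_conv_scc_of)
  also have "\<dots> = set ` set css"
  proof (intro equalityI subsetI)
    fix S assume "S \<in> scc_of ` verts G"
    then show "S \<in> set ` set css" using scc css(1)[symmetric] by auto
  next
    fix S assume "S \<in> set ` set css"
    then obtain cs where cs: "cs \<in> set css" "S = set cs" by auto
    then obtain x where x: "x \<in> set cs" using css(3) by (metis hd_in_set)
    then have "x \<in> verts G" using cs css(1) by auto
    then show "S \<in> scc_of ` verts G" using scc[OF cs(1) x] cs(2) by auto
  qed
  finally have "sccs_verts = set ` set css" .
  \<comment> \<open>Disjoint nonempty lists have different vertex sets, so counting sets is the same
    as counting lists.\<close>
  moreover have "inj_on set (set css)"
    using css(2,3) unfolding inj_on_def by (metis distinct_concat_iff inf.idem set_empty)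
  moreover have "distinct css" using css(2,3) by (simp add: distinct_concat_iff removeAll_id)
  ultimately show ?thesis
    by (metis card_image card_sccs_verts distinct_card)
qed

section \<open>The sign of the rotation\<close>

text \<open>\<open>?L\<close> subtracts row 0 from all other rows and \<open>?R\<close> adds all
  other columns to column 0. Both have determinant 1, and the product \<open>?L * ?A * ?R\<close> is
  upper triangular with diagonal \<open>1 + v t, 1, ..., 1\<close>.\<close>

lemma det_one_plus_smult_ones:
  fixes t :: "'a :: comm_ring_1"
  shows "det (mat v v (\<lambda>(i, j). (if i = j then 1 else 0) + t)) = 1 + of_nat v * t"
proof (cases v)
  case 0
  then show ?thesis by (simp add: det_def)
next
  case (Suc w)
  let ?A = "mat v v (\<lambda>(i, j). (if i = j then 1 else 0) + t)"
  let ?L = "mat v v (\<lambda>(i, j). if i = j then 1 else if j = 0 then - 1 else (0 :: 'a))"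
  let ?R = "mat v v (\<lambda>(i, j). if i = j then 1 else if j = 0 then 1 else (0 :: 'a))"
  let ?U = "mat v v (\<lambda>(i, j). if i = 0 then if j = 0 then 1 + of_nat v * t else t
                       else if i = j then 1 else (0 :: 'a))"
  have v: "0 < v" using Suc by simp
  have LA: "?L * ?A = mat v v (\<lambda>(i, j). if i = 0 then (if j = 0 then 1 else 0) + t
                else (if i = j then 1 else 0) - (if j = 0 then 1 else 0))" (is "_ = ?B")
  proof (intro eq_matI)
    fix i j assume "i < dim_row ?B" "j < dim_col ?B"
    then have ij: "i < v" "j < v" by auto
    have "(?L * ?A) $$ (i, j) = (\<Sum>k<v. (if i = k then 1 else if k = 0 then - 1 else 0) *
        ((if k = j then 1 else 0) + t))"
      using ij by (simp add: scalar_prod_def atLeast0LessThan)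
    also have "\<dots> = (\<Sum>k<v. (if k = i then (if k = j then 1 else 0) + t else 0) -
        (if k = 0 then if i = 0 then 0 else (if k = j then 1 else 0) + t else 0))"
      by (rule sum.cong) auto
    also have "\<dots> = ?B $$ (i, j)"
      using ij v by (simp add: sum_subtractf)
    finally show "(?L * ?A) $$ (i, j) = ?B $$ (i, j)" .
  qed auto
  have pick_column: "(\<Sum>k<v. f k * (if k = j then 1 else if j = 0 then 1 else 0)) =
      (if j = 0 then \<Sum>k<v. f k else f j)" if "j < v" for f :: "nat \<Rightarrow> 'a" and j
  proof (cases "j = 0")
    case False
    then have "(\<Sum>k<v. f k * (if k = j then 1 else if j = 0 then 1 else 0)) =
        (\<Sum>k<v. if k = j then f k else 0)"
      by (intro sum.cong) auto
    then show ?thesis using False that by simp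
  qed simp
  have BR: "?B * ?R = ?U"
  proof (intro eq_matI)
    fix i j assume "i < dim_row ?U" "j < dim_col ?U"
    then have ij: "i < v" "j < v" by auto
    have "(?B * ?R) $$ (i, j) = (\<Sum>k<v. (if i = 0 then (if k = 0 then 1 else 0) + t
                else (if i = k then 1 else 0) - (if k = 0 then 1 else 0)) *
        (if k = j then 1 else if j = 0 then 1 else 0))"
      using ij by (simp add: scalar_prod_def atLeast0LessThan)
    also have "\<dots> = (if j = 0 then \<Sum>k<v. if i = 0 then (if k = 0 then 1 else 0) + t
          else (if i = k then 1 else 0) - (if k = 0 then 1 else 0)
        else if i = 0 then t else if i = j then 1 else 0)"
      by (subst pick_column[OF ij(2)]) auto
    also have "\<dots> = ?U $$ (i, j)"
      using ij v by (cases "i = 0") (simp_all add: sum.distrib sum_subtractf)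
    finally show "(?B * ?R) $$ (i, j) = ?U $$ (i, j)" .
  qed auto
  have tri: "det M = prod_list (diag_mat M)" if "M \<in> carrier_mat v v" 
    "\<And>i j. i < j \<Longrightarrow> j < v \<Longrightarrow> M $$ (i, j) = 0" for M :: "'a mat"
    using det_lower_triangular[of v M] that by auto
  have "det ?L = 1" "det ?R = 1"
    by (subst tri; simp add: prod_list_diag_prod)+
  moreover have "det ?U = 1 + of_nat v * t"
  proof -
    have "det ?U = prod_list (diag_mat ?U)"
      by (rule det_upper_triangular[of _ v]) (auto simp: upper_triangular_def)
    also have "\<dots> = (\<Prod>i<v. if i = 0 then 1 + of_nat v * t else 1)"
      unfolding prod_list_diag_prod by (rule prod.cong) (auto simp: atLeast0LessThan)
    also have "\<dots> = 1 + of_nat v * t" using v by (subst prod.delta) simp_all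
    finally show ?thesis .
  qed
  moreover have "det ?U = det ?L * det ?A * det ?R"
  proof -
    have "det ?U = det ((?L * ?A) * ?R)" unfolding LA BR ..
    also have "\<dots> = det (?L * ?A) * det ?R"
      by (rule det_mult[of _ v]) (auto intro!: mult_carrier_mat[of _ v v])
    also have "det (?L * ?A) = det ?L * det ?A" by (rule det_mult[of _ v]) auto
    finally show ?thesis .
  qed
  ultimately show ?thesis by simp
qed

text \<open>The matrix \<open>I - x S\<close>, where \<open>S\<close> is the permutation matrix of \<open>s\<close>.\<close>

definition shift_mat :: "nat \<Rightarrow> (nat \<Rightarrow> nat) \<Rightarrow> 'a :: comm_ring_1 \<Rightarrow> 'a mat" where
  "shift_mat v s x = mat v v (\<lambda>(i, j). (if i = j then 1 else 0) - (if j = s i then x else 0))"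

lemma shift_mat_carrier [simp]: "shift_mat v s x \<in> carrier_mat v v"
  by (simp add: shift_mat_def)

text \<open>Since \<open>S S\<^sup>T = I\<close> and \<open>x y = 1\<close>, one has
  \<open>I - x S = - x S (I - y S)\<^sup>T\<close>. Multiplication by \<open>S\<close> permutes rows
  and contributes the sign of \<open>s\<close>.\<close>

lemma det_shift_mat_reciprocal:
  fixes x y :: "'a :: comm_ring_1"
  assumes s: "s permutes {0..<v}" and xy: "x * y = 1"
  shows "det (shift_mat v s x) = (- x) ^ v * of_int (sign s) * det (shift_mat v s y)"
proof -
  let ?T = "transpose_mat (shift_mat v s y)"
  have in_v: "s i < v" if "i < v" for i using permutes_in_image[OF s, of i] that by simp
  have "shift_mat v s x = (- x) \<cdot>\<^sub>m mat v v (\<lambda>(i, j). ?T $$ (s i, j))"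
    using xy in_v permutes_inj[OF s]
    by (intro eq_matI) (auto simp: shift_mat_def inj_eq algebra_simps)
  moreover have "det (mat v v (\<lambda>(i, j). ?T $$ (s i, j))) = of_int (sign s) * det ?T"
    using det_permute_rows[of ?T v s] s by simp
  ultimately show ?thesis
    using det_transpose[of "shift_mat v s y" v] by (simp add: mult.assoc)
qed

text \<open>A kernel vector satisfies \<open>w $ i = y * w $ s i\<close>. At an entry of maximal
  modulus this contradicts \<open>\<bar>y\<bar> < 1\<close>.\<close>

lemma det_shift_mat_nonzero:
  fixes y :: real
  assumes s: "s permutes {0..<v}" and y: "\<bar>y\<bar> < 1"
  shows "det (shift_mat v s y) \<noteq> 0"
proof
  assume "det (shift_mat v s y) = 0"
  then obtain w where w: "w \<in> carrier_vec v" "w \<noteq> 0\<^sub>v v" "shift_mat v s y *\<^sub>v w = 0\<^sub>v v"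
    using det_0_iff_vec_prod_zero[OF shift_mat_carrier] by blast
  have in_v: "s i < v" if "i < v" for i using permutes_in_image[OF s, of i] that by simp
  have eq: "w $ i = y * w $ s i" if "i < v" for i
  proof -
    have "0 = (shift_mat v s y *\<^sub>v w) $ i" using w that by simp
    also have "\<dots> = (\<Sum>k<v. ((if i = k then 1 else 0) - (if k = s i then y else 0)) * w $ k)"
      using w(1) that by (simp add: shift_mat_def scalar_prod_def atLeast0LessThan)
    also have "\<dots> = (\<Sum>k<v. (if k = i then w $ k else 0) - (if k = s i then y * w $ k else 0))"
      by (rule sum.cong) (auto simp: algebra_simps)
    also have "\<dots> = w $ i - y * w $ s i" unfolding sum_subtractf using that in_v by simp
    finally show ?thesis by simp
  qed
  obtain j where j: "j < v" "w $ j \<noteq> 0" using w(1,2) by (metis carrier_vecD eq_vecI index_zero_vec)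
  have "\<exists>i<v. \<forall>k<v. \<bar>w $ k\<bar> \<le> \<bar>w $ i\<bar>"
    using obtains_MAX[of "{..<v}" "\<lambda>k. \<bar>w $ k\<bar>"] j
    by (metis (no_types, lifting) Max_ge emptyE finite_imageI finite_lessThan image_eqI lessThan_iff)
  then obtain i where i: "i < v" "\<And>k. k < v \<Longrightarrow> \<bar>w $ k\<bar> \<le> \<bar>w $ i\<bar>" by blast
  have "0 < \<bar>w $ i\<bar>" using i(2)[OF j(1)] j(2) by linarith
  moreover have "\<bar>w $ i\<bar> = \<bar>y\<bar> * \<bar>w $ s i\<bar>" using eq[OF i(1)] by (metis abs_mult)
  moreover have "\<bar>y\<bar> * \<bar>w $ s i\<bar> \<le> \<bar>y\<bar> * \<bar>w $ i\<bar>" using i in_v by (intro mult_left_mono) auto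
  moreover have "\<bar>y\<bar> * \<bar>w $ i\<bar> < 1 * \<bar>w $ i\<bar>" using calculation(1) y by (intro mult_strict_right_mono)
  ultimately show False by linarith
qed


section \<open>Conjugation in the quadratic field generated by \<open>a\<close>\<close>

text \<open>The pair \<open>x\<close>, \<open>y\<close> consists of an element of \<open>\<rat>(a)\<close> and its image under \<open>a \<mapsto> b\<close>. For
  irrational \<open>a\<close> the image is unique, which is the content of \<open>conj_pair_eq_0\<close>.\<close>

definition conj_pair :: "real \<Rightarrow> real \<Rightarrow> real \<Rightarrow> real \<Rightarrow> bool" where
  "conj_pair a b x y \<longleftrightarrow> (\<exists>p\<in>\<rat>. \<exists>q\<in>\<rat>. x = p + q * a \<and> y = p + q * b)"

lemma conj_pair_Rats: "x \<in> \<rat> \<Longrightarrow> conj_pair a b x x"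
  unfolding conj_pair_def by (rule bexI[of _ x], rule bexI[of _ 0]) auto

lemma conj_pair_root: "conj_pair a b a b"
  unfolding conj_pair_def by (rule bexI[of _ 0], rule bexI[of _ 1]) auto

lemma conj_pair_diff: "conj_pair a b x y \<Longrightarrow> conj_pair a b x' y' \<Longrightarrow> conj_pair a b (x - x') (y - y')"
proof -
  assume "conj_pair a b x y" "conj_pair a b x' y'"
  then obtain p q p' q' where *: "p \<in> \<rat>" "q \<in> \<rat>" "p' \<in> \<rat>" "q' \<in> \<rat>"
    "x = p + q * a" "y = p + q * b" "x' = p' + q' * a" "y' = p' + q' * b"
    unfolding conj_pair_def by blast
  show ?thesis
    unfolding conj_pair_def
    by (rule bexI[of _ "p - p'"], rule bexI[of _ "q - q'"]) (use * in \<open>auto simp: algebra_simps\<close>)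
qed

lemma conj_pair_add: "conj_pair a b x y \<Longrightarrow> conj_pair a b x' y' \<Longrightarrow> conj_pair a b (x + x') (y + y')"
  using conj_pair_diff[of a b x y "0 - x'" "0 - y'"] conj_pair_diff[of a b 0 0 x' y']
    conj_pair_Rats[of 0 a b] by simp

lemma conj_pair_eq_0:
  assumes "conj_pair a b 0 y" "a \<notin> \<rat>" shows "y = 0"
proof -
  obtain p q where pq: "p \<in> \<rat>" "q \<in> \<rat>" "0 = p + q * a" "y = p + q * b"
    using assms(1) unfolding conj_pair_def by blast
  have "q = 0"
  proof (rule ccontr)
    assume "q \<noteq> 0"
    then have "a = - p / q" using pq(3) by (simp add: field_simps)
    then show False using pq(1,2) assms(2) by simp
  qed
  then show ?thesis using pq by simp
qed

lemma conj_pair_sum: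
  "(\<And>i. i \<in> I \<Longrightarrow> conj_pair a b (f i) (g i)) \<Longrightarrow> conj_pair a b (sum f I) (sum g I)"
  by (induction I rule: infinite_finite_induct) (auto intro: conj_pair_add conj_pair_Rats)

context
  fixes a b :: real
  assumes sum_Rats: "a + b \<in> \<rat>" and prod_Rats: "a * b \<in> \<rat>"
begin

text \<open>Both numbers satisfy \<open>X * X = (a + b) * X - a * b\<close>, whose coefficients are
  rational, so products reduce to the same rational coordinates on both sides.\<close>

lemma conj_pair_mult:
  assumes "conj_pair a b x y" "conj_pair a b x' y'"
  shows "conj_pair a b (x * x') (y * y')"
proof -
  obtain p q p' q' where *: "p \<in> \<rat>" "q \<in> \<rat>" "p' \<in> \<rat>" "q' \<in> \<rat>"
    "x = p + q * a" "y = p + q * b" "x' = p' + q' * a" "y' = p' + q' * b"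
    using assms unfolding conj_pair_def by blast
  show ?thesis
    unfolding conj_pair_def
    by (rule bexI[of _ "p * p' - q * q' * (a * b)"],
        rule bexI[of _ "p * q' + q * p' + q * q' * (a + b)"])
      (use * sum_Rats prod_Rats in \<open>simp_all only: Rats_add Rats_mult Rats_diff\<close>, simp_all add: algebra_simps)
qed

text \<open>Conjugation is an involution because \<open>b = (a + b) - a\<close>.\<close>

lemma conj_pair_swap:
  assumes "conj_pair a b x y" shows "conj_pair a b y x"
proof -
  obtain p q where *: "p \<in> \<rat>" "q \<in> \<rat>" "x = p + q * a" "y = p + q * b"
    using assms unfolding conj_pair_def by blast
  show ?thesis
    unfolding conj_pair_def
    by (rule bexI[of _ "p + q * (a + b)"], rule bexI[of _ "- q"])
      (use * sum_Rats in \<open>simp_all only: Rats_add Rats_mult Rats_minus_iff\<close>, simp_all add: algebra_simps)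
qed

lemma conj_pair_prod:
  "(\<And>i. i \<in> I \<Longrightarrow> conj_pair a b (f i) (g i)) \<Longrightarrow> conj_pair a b (prod f I) (prod g I)"
  by (induction I rule: infinite_finite_induct) (auto intro: conj_pair_mult conj_pair_Rats)

lemma conj_pair_power: "conj_pair a b x y \<Longrightarrow> conj_pair a b (x ^ k) (y ^ k)"
  by (induction k) (auto intro: conj_pair_mult conj_pair_Rats)

text \<open>By the Leibniz formula the determinant is an integer polynomial in the parameter, and
  conjugation respects sums and products.\<close>

lemma conj_pair_det_shift_mat: "conj_pair a b (det (shift_mat v s a)) (det (shift_mat v s b))"
  unfolding det_def'[OF shift_mat_carrier]
proof (intro conj_pair_sum conj_pair_mult conj_pair_prod)
  fix p i assume "p \<in> {p. p permutes {0..<v}}" "i \<in> {0..<v}"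
  then have "p i < v" "i < v" by (auto dest: permutes_in_image[of p _ i])
  then show "conj_pair a b (shift_mat v s a $$ (i, p i)) (shift_mat v s b $$ (i, p i))"
    by (auto simp: shift_mat_def simp del: diff_0 intro!: conj_pair_diff conj_pair_root conj_pair_Rats)
qed (auto intro: conj_pair_Rats)

end

section \<open>The Gram matrix and the sign it forces\<close>

text \<open>If \<open>a = p / q\<close> in lowest terms, then
  \<open>p * p + q * q = n * p * q\<close>. So each of \<open>p\<close>, \<open>q\<close> divides
  the square of the other, both are 1, and \<open>a = 1\<close>.\<close>

lemma reciprocal_root_irrational:
  fixes a b :: real and n :: nat
  assumes "a + b = n" "a * b = 1" "1 < a"
  shows "a \<notin> \<rat>"
proof
  assume "a \<in> \<rat>"
  then obtain p q :: nat where pq: "q \<noteq> 0" "\<bar>a\<bar> = p / q" "coprime p q"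
    by (rule Rats_abs_nat_div_natE)
  have a: "a = p / q" using pq assms by simp
  have "b = 1 / a" using assms by (simp add: field_simps)
  then have "real p / q + q / p = n" using assms(1) a by simp
  moreover have "p \<noteq> 0" using a assms(3) by (intro notI) simp
  ultimately have "real (p * p + q * q) = real (n * p * q)"
    using pq(1) by (simp add: field_simps)
  then have *: "p * p + q * q = n * p * q" using of_nat_eq_iff by blast
  have "p dvd q * q" using * by (metis dvd_add_right_iff dvd_triv_left dvd_triv_right dvd_mult2)
  then have "p = 1" using pq(3)
    by (metis coprime_dvd_mult_left_iff coprime_absorb_left nat_dvd_1_iff_1)
  have "q dvd p * p" using * by (metis dvd_add_left_iff dvd_triv_right)
  then have "q = 1" using \<open>p = 1\<close> by simp
  then show False using a \<open>p = 1\<close> assms(3) by simp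
qed

text \<open>Expanding \<open>a (I - b S) (I - b S)\<^sup>T\<close> gives
  \<open>(a + a b b) I - a b (S + S\<^sup>T)\<close>, where \<open>a b = 1\<close> and
  \<open>a + b = n\<close>.\<close>

lemma shift_mat_gram:
  fixes a b :: real and n :: nat
  assumes s: "s permutes {0..<v}" and ab: "a + b = n" "a * b = 1" and ij: "i < v" "j < v"
  shows "a * (\<Sum>k<v. shift_mat v s b $$ (i, k) * shift_mat v s b $$ (j, k)) =
    (if j = i then real n else 0) - (if j = s i then 1 else 0) - (if j = inv_into UNIV s i then 1 else 0)"
proof -
  have in_v: "s i < v" "s j < v" using permutes_in_image[OF s, of i] permutes_in_image[OF s, of j] ij by auto
  have sij: "s j = s i \<longleftrightarrow> j = i" using permutes_inj[OF s] by (simp add: inj_eq)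
  have inv: "j = inv_into UNIV s i \<longleftrightarrow> s j = i" using s by (metis permutes_inverses)
  \<comment> \<open>Row \<open>i\<close> is supported on the columns \<open>i\<close> and
    \<open>s i\<close>, so only these two values of \<open>k\<close> contribute.\<close>
  have "(\<Sum>k<v. shift_mat v s b $$ (i, k) * shift_mat v s b $$ (j, k)) =
      (\<Sum>k<v. (if k = i then (if j = i then 1 else 0) - (if i = s j then b else 0) else 0) -
        (if k = s i then (if j = s i then b else 0) - (if s i = s j then b * b else 0) else 0))"
    using ij by (intro sum.cong) (auto simp: shift_mat_def algebra_simps)
  also have "\<dots> = (if j = i then 1 + b * b else 0) - (if j = s i then b else 0) - (if s j = i then b else 0)"
    using ij in_v sij by (auto simp: sum_subtractf)
  also have "a * \<dots> = (if j = i then a + (a * b) * b else 0) - (if j = s i then a * b else 0)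
       - (if s j = i then a * b else 0)"
    by (simp add: algebra_simps)
  finally show ?thesis using ab inv by simp
qed

text \<open>\<open>G = n I - S - S\<^sup>T\<close> has constant row sums, so
  \<open>A A\<^sup>T = G + J\<close> factors as \<open>G (I + t J)\<close>, and the determinants of
  both factors are known.\<close>

lemma gram_det:
  fixes a b :: real and n v :: nat and A :: "real mat"
  assumes n: "3 \<le> n" and v: "v = n\<^sup>2 + n + 3" and s: "s permutes {0..<v}"
    and ab: "a + b = n" "a * b = 1"
    and moves: "\<And>i. i < v \<Longrightarrow> s i \<noteq> i" "\<And>i. i < v \<Longrightarrow> s (s i) \<noteq> i"
    and A: "A \<in> carrier_mat v v"
    and gram: "\<And>i j. i < v \<Longrightarrow> j < v \<Longrightarrow> (\<Sum>k<v. A $$ (i, k) * A $$ (j, k)) =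
      (if j = i then n + 1 else if j = s i \<or> i = s j then 0 else 1)"
  shows "(real n - 2) * (det A)\<^sup>2 = (real n + 1)\<^sup>2 * (a ^ v * (det (shift_mat v s b))\<^sup>2)"
proof -
  \<comment> \<open>As \<open>G J = (n - 2) J\<close>, this value turns \<open>G (I + t J)\<close>
    into \<open>G + J\<close>; \<open>n \<ge> 3\<close> keeps the denominator nonzero.\<close>
  define t where "t = 1 / (real n - 2)"
  have t: "(real n - 2) * t = 1" using n by (simp add: t_def)
  define g where "g i j = (if j = i then real n else 0) - (if j = s i then 1 else 0)
    - (if j = inv_into UNIV s i then 1 else 0)" for i j
  let ?Q = "shift_mat v s b"
  let ?J = "mat v v (\<lambda>(i, j). (if i = j then 1 else 0) + t)"
  have inv_v: "inv_into UNIV s i < v" if "i < v" for i using permutes_in_image[OF permutes_inv[OF s], of i] that by simp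
  have in_v: "s i < v" if "i < v" for i using permutes_in_image[OF s, of i] that by simp
  have inv: "j = inv_into UNIV s i \<longleftrightarrow> i = s j" for i j using s by (metis permutes_inverses)
  have QQ: "a \<cdot>\<^sub>m (?Q * transpose_mat ?Q) = mat v v (\<lambda>(i, j). g i j)" (is "_ = ?G")
  proof (intro eq_matI)
    fix i j assume "i < dim_row ?G" "j < dim_col ?G"
    then have ij: "i < v" "j < v" by auto
    have "(?Q * transpose_mat ?Q) $$ (i, j) = (\<Sum>k<v. ?Q $$ (i, k) * ?Q $$ (j, k))"
      using ij by (simp add: shift_mat_def scalar_prod_def atLeast0LessThan)
    then show "(a \<cdot>\<^sub>m (?Q * transpose_mat ?Q)) $$ (i, j) = ?G $$ (i, j)"
      using shift_mat_gram[OF s ab ij] ij by (simp add: shift_mat_def g_def)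
  qed (auto simp: shift_mat_def)
  have row: "(\<Sum>k<v. g i k) = real n - 2" if "i < v" for i
    using that in_v inv_v by (simp add: g_def sum_subtractf)
  have GJ: "A * transpose_mat A = ?G * ?J"
  proof (intro eq_matI)
    fix i j assume "i < dim_row (?G * ?J)" "j < dim_col (?G * ?J)"
    then have ij: "i < v" "j < v" by auto
    have "(?G * ?J) $$ (i, j) = (\<Sum>k<v. g i k * ((if k = j then 1 else 0) + t))"
      using ij by (simp add: scalar_prod_def atLeast0LessThan)
    also have "\<dots> = (\<Sum>k<v. (if k = j then g i k else 0) + g i k * t)"
      by (intro sum.cong) (auto simp: algebra_simps)
    also have "\<dots> = g i j + 1"
      using ij t row[OF ij(1)] by (simp add: sum.distrib sum_distrib_right[symmetric])
    \<comment> \<open>At most one of the three terms of \<open>g i j\<close> is nonzero, because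
      \<open>s\<close> has neither fixed points nor 2-cycles.\<close>
    also have "\<dots> = (if j = i then n + 1 else if j = s i \<or> i = s j then 0 else 1)"
      using moves[OF ij(1)] moves[OF ij(2)] moves[OF ij(1), symmetric] moves[OF ij(2), symmetric]
      unfolding g_def inv by auto
    also have "\<dots> = (A * transpose_mat A) $$ (i, j)"
      using gram[OF ij] ij A by (simp add: scalar_prod_def atLeast0LessThan)
    finally show "(A * transpose_mat A) $$ (i, j) = (?G * ?J) $$ (i, j)" by simp
  qed (use A in auto)
  have "(det A)\<^sup>2 = det (A * transpose_mat A)"
    using det_mult[of A v "transpose_mat A"] det_transpose[OF A] A by (simp add: power2_eq_square)
  also have "\<dots> = det ?G * det ?J" unfolding GJ by (rule det_mult[of _ v]) auto
  also have "det ?J = 1 + v * t" by (rule det_one_plus_smult_ones)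
  also have "det ?G = a ^ v * det (?Q * transpose_mat ?Q)"
    unfolding QQ[symmetric] by (simp add: shift_mat_def)
  also have "det (?Q * transpose_mat ?Q) = (det ?Q)\<^sup>2"
    using det_mult[of ?Q v "transpose_mat ?Q"] det_transpose[of ?Q v] by (simp add: power2_eq_square)
  finally have "(real n - 2) * (det A)\<^sup>2 = a ^ v * (det ?Q)\<^sup>2 * ((real n - 2) + v * ((real n - 2) * t))"
    by (simp add: algebra_simps)
  \<comment> \<open>Deficiency 3 makes \<open>n - 2 + v\<close> a perfect square.\<close>
  also have "(real n - 2) + v * ((real n - 2) * t) = (real n + 1)\<^sup>2"
    unfolding t v by (simp add: power2_eq_square algebra_simps)
  finally show ?thesis by simp
qed

lemma gram_sign:
  fixes n v :: nat and A :: "real mat"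
  assumes n: "3 \<le> n" and v: "v = n\<^sup>2 + n + 3" and s: "s permutes {0..<v}"
    and moves: "\<And>i. i < v \<Longrightarrow> s i \<noteq> i" "\<And>i. i < v \<Longrightarrow> s (s i) \<noteq> i"
    and A: "A \<in> carrier_mat v v"
    and Rats: "\<And>i j. i < v \<Longrightarrow> j < v \<Longrightarrow> A $$ (i, j) \<in> \<rat>"
    and gram: "\<And>i j. i < v \<Longrightarrow> j < v \<Longrightarrow> (\<Sum>k<v. A $$ (i, k) * A $$ (j, k)) =
      (if j = i then n + 1 else if j = s i \<or> i = s j then 0 else 1)"
  shows "sign s = 1"
proof -
  define r where "r = sqrt ((real n)\<^sup>2 - 4)"
  define a where "a = (n + r) / 2"
  define b where "b = (n - r) / 2"
  have "3\<^sup>2 \<le> (real n)\<^sup>2" using n by (intro power_mono) auto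
  then have r: "r\<^sup>2 = (real n)\<^sup>2 - 4" "0 < r" by (auto simp: r_def)
  have ab: "a + b = n" "a * b = 1"
    using r(1) by (simp_all add: a_def b_def power2_eq_square field_simps)
  have a: "1 < a" using n r(2) by (simp add: a_def)
  have "b = 1 / a" using ab(2) a by (simp add: field_simps)
  then have b: "\<bar>b\<bar> < 1" using a by simp
  have irr: "a \<notin> \<rat>" by (rule reciprocal_root_irrational[OF ab a])
  define d where "d = det (shift_mat v s b)"
  define d' where "d' = det (shift_mat v s a)"
  have d: "d \<noteq> 0" unfolding d_def by (rule det_shift_mat_nonzero[OF s b])
  \<comment> \<open>\<open>v\<close> is odd, so one further factor \<open>a\<close> turns
    \<open>a ^ v\<close> into the square of \<open>a ^ k\<close>.\<close>
  define k where "k = (v + 1) div 2"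
  have "odd v" unfolding v by simp
  then have k: "v + 1 = 2 * k" by (simp add: k_def)
  have detR: "det A \<in> \<rat>"
  proof -
    have "(\<Prod>i = 0..<v. A $$ (i, p i)) \<in> \<rat>" if "p permutes {0..<v}" for p
      using Rats permutes_in_image[OF that] by (intro Rats_prod) auto
    then show ?thesis unfolding det_def'[OF A] by (intro Rats_sum Rats_mult) auto
  qed
  define x where "x = det A / (real n + 1)"
  have x: "x \<in> \<rat>" unfolding x_def using detR by simp
  have "(real n - 2) * x\<^sup>2 = a ^ v * d\<^sup>2"
    using gram_det[OF n v s ab moves A gram] unfolding x_def d_def by (simp add: field_simps)
  \<comment> \<open>That factor \<open>a\<close> also turns \<open>n - 2\<close> into a square,
    since \<open>a (a + b - 2) = a * a + 1 - 2 a\<close>.\<close>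
  moreover have "a * (real n - 2) = (a - 1)\<^sup>2"
    using ab by (simp add: power2_eq_square algebra_simps flip: ab(1))
  moreover have "a * a ^ v = (a ^ k)\<^sup>2"
    using k by (metis power_Suc power_mult mult.commute Suc_eq_plus1)
  ultimately have "((a - 1) * x)\<^sup>2 = (a ^ k * d)\<^sup>2"
    unfolding power_mult_distrib by (metis mult.assoc)
  \<comment> \<open>\<open>y\<close> is \<open>x\<close> or \<open>- x\<close>, according to the
    sign left open by the square root.\<close>
  then obtain y where y: "y \<in> \<rat>" "a ^ k * d = (a - 1) * y"
    using x by (metis Rats_minus_iff mult_minus_right power2_eq_iff)
  have Rats': "a + b \<in> \<rat>" "a * b \<in> \<rat>" unfolding ab by auto
  \<comment> \<open>The first entry vanishes by choice of \<open>y\<close>, so irrationality of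
    \<open>a\<close> makes its conjugate vanish too. The determinant pair is swapped because
    \<open>d\<close> belongs to \<open>b\<close>.\<close>
  have "conj_pair a b (a ^ k * d - (a - 1) * y) (b ^ k * d' - (b - 1) * y)"
    unfolding d_def d'_def
    by (intro conj_pair_diff conj_pair_mult conj_pair_power conj_pair_root
        conj_pair_swap[OF Rats' conj_pair_det_shift_mat[OF Rats']] conj_pair_Rats Rats' y(1)) simp
  then have y': "b ^ k * d' = (b - 1) * y" using conj_pair_eq_0 irr y(2) by force
  have d': "d' = - (a ^ v * of_int (sign s) * d)"
    unfolding d_def d'_def using det_shift_mat_reciprocal[OF s ab(2)] \<open>odd v\<close> by simp
  \<comment> \<open>The factor \<open>a\<close> turns \<open>b - 1\<close> into
    \<open>1 - a\<close>; inserting \<open>d'\<close> then leaves \<open>a ^ k * d\<close> on both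
    sides, up to the sign of \<open>s\<close>.\<close>
  have "a * (b ^ k * d') = a * ((b - 1) * y)" by (simp only: y')
  then have "- (of_int (sign s) * ((a * a ^ v) * b ^ k * d)) = (a * b - a) * y"
    unfolding d' by (simp add: algebra_simps)
  moreover have "(a * a ^ v) * b ^ k = a ^ k"
  proof -
    have "(a * a ^ v) * b ^ k = a ^ k * (a * b) ^ k"
      unfolding \<open>a * a ^ v = (a ^ k)\<^sup>2\<close> by (simp add: power2_eq_square power_mult_distrib)
    then show ?thesis by (simp add: ab)
  qed
  moreover have "(a * b - a) * y = - (a ^ k * d)"
    unfolding y(2) ab(2) by (simp add: algebra_simps)
  ultimately have "of_int (sign s) * (a ^ k * d) = 1 * (a ^ k * d)" by simp
  then have "real_of_int (sign s) = 1" using d a by (subst (asm) mult_cancel_right) simp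
  then show ?thesis by linarith
qed

section \<open>Uniqueness of the configuration with a triangle and a hexagon\<close>

lemma card_lines_9_1: "card lines_9_1 = 9"
proof -
  let ?xs = "[{0,1,2}, {3,4,5}, {6,7,8}, {0,3,6}, {0,4,7}, {1,3,7}, {1,5,8}, {2,4,8}, {2,5,6 :: nat}]"
  have "distinct ?xs" by code_simp
  then have "card (set ?xs) = length ?xs" by (rule distinct_card)
  also have "set ?xs = lines_9_1" by (simp only: lines_9_1_def list.set)
  also have "length ?xs = 9" by (simp only: list.size)
  finally show ?thesis .
qed

lemma configuration_iso_sym:
  assumes "configuration_iso P L P' L'" "\<forall>l\<in>L. l \<subseteq> P"
  shows "configuration_iso P' L' P L"
proof -
  obtain f where f: "bij_betw f P P'" "(`) f ` L = L'"
    using assms(1) by (auto simp: configuration_iso_def)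
  let ?g = "the_inv_into P f"
  have "?g ` f ` l = l" if "l \<in> L" for l
  proof -
    have "?g (f x) = x" if "x \<in> l" for x
      using f(1) \<open>l \<in> L\<close> that assms(2) by (auto simp: bij_betw_def intro: the_inv_into_f_f)
    then show ?thesis by force
  qed
  then have "(`) ?g ` L' = L" unfolding f(2)[symmetric] by (force simp: image_image)
  then show ?thesis
    unfolding configuration_iso_def using bij_betw_the_inv_into[OF f(1)] by blast
qed

text \<open>\<open>T\<close> stands for the hexagon and \<open>M\<close> for the triangle. A point
  is the pair of hexagon lines through it, that is, an edge of the triangular prism complementary to
  the 6-cycle; each line in \<open>M\<close> is a perfect matching of that prism.\<close>

lemma hexagon_triangle_iso_9_1:
  assumes conf: "symmetric_configuration P L 9 3"
    and TL: "\<And>k. k < 6 \<Longrightarrow> T k \<in> L" and sub: "M \<subseteq> L"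
    and meet: "\<And>i j. i < 6 \<Longrightarrow> j < 6 \<Longrightarrow> j \<noteq> i \<Longrightarrow> j \<noteq> Suc i mod 6 \<Longrightarrow> i \<noteq> Suc j mod 6 \<Longrightarrow> T i \<inter> T j \<noteq> {}"
    and two: "\<And>p. p \<in> P \<Longrightarrow> card {k. k < 6 \<and> p \<in> T k} = 2"
    and transversal: "\<And>X k. X \<in> M \<Longrightarrow> k < 6 \<Longrightarrow> X \<noteq> T k \<and> X \<inter> T k \<noteq> {}"
    and cover: "\<And>p. p \<in> P \<Longrightarrow> \<exists>X\<in>M. p \<in> X"
  shows "configuration_iso P L points_9_1 lines_9_1"
proof -
  interpret symmetric_configuration P L 9 3 by fact
  define sig where "sig p = {k. k < 6 \<and> p \<in> T k}" for p
  have ex: "\<exists>p. p \<in> P \<and> p \<in> T i \<and> p \<in> T j \<and> sig p = {i, j}"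
    if "i < 6" "j < 6" "j \<noteq> i" "j \<noteq> Suc i mod 6" "i \<noteq> Suc j mod 6" for i j
  proof -
    from meet[OF that] obtain p where p: "p \<in> T i" "p \<in> T j" by blast
    then have "p \<in> P" using line_subset[OF TL[OF \<open>i < 6\<close>]] by blast
    moreover have "{i, j} = sig p"
      by (rule card_subset_eq) (use p that two[OF \<open>p \<in> P\<close>] in \<open>auto simp: sig_def\<close>)
    ultimately show ?thesis using p by blast
  qed
  \<comment> \<open>The names \<open>a\<close> to \<open>i\<close> follow the labels 0 to 8 of the
    target, so that \<open>a b c\<close>, \<open>d e f\<close> and \<open>g h i\<close> will be the
    lines in \<open>M\<close>.\<close>
  obtain a where a: "a \<in> P" "a \<in> T 0" "a \<in> T 2" "sig a = {0, 2}" using ex[of 0 2] by auto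
  obtain b where b: "b \<in> P" "b \<in> T 1" "b \<in> T 4" "sig b = {1, 4}" using ex[of 1 4] by auto
  obtain c where c: "c \<in> P" "c \<in> T 3" "c \<in> T 5" "sig c = {3, 5}" using ex[of 3 5] by auto
  obtain d where d: "d \<in> P" "d \<in> T 0" "d \<in> T 4" "sig d = {0, 4}" using ex[of 0 4] by auto
  obtain e where e: "e \<in> P" "e \<in> T 2" "e \<in> T 5" "sig e = {2, 5}" using ex[of 2 5] by auto
  obtain f where f: "f \<in> P" "f \<in> T 1" "f \<in> T 3" "sig f = {1, 3}" using ex[of 1 3] by auto
  obtain g where g: "g \<in> P" "g \<in> T 0" "g \<in> T 3" "sig g = {0, 3}" using ex[of 0 3] by auto
  obtain h where h: "h \<in> P" "h \<in> T 2" "h \<in> T 4" "sig h = {2, 4}" using ex[of 2 4] by auto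
  obtain i where i: "i \<in> P" "i \<in> T 1" "i \<in> T 5" "sig i = {1, 5}" using ex[of 1 5] by auto
  note pts = a b c d e f g h i
  \<comment> \<open>Nine different signatures separate the nine points.\<close>
  have "distinct (map sig [a, b, c, d, e, f, g, h, i])"
    unfolding list.map pts by code_simp
  then have dist: "distinct [a, b, c, d, e, f, g, h, i]" by (simp only: distinct_map)
  have line3: "l = {x, y, z}" if "l \<in> L" "x \<in> l" "y \<in> l" "z \<in> l" "distinct [x, y, z]" for l x y z
    using that card_line[OF that(1)] card_subset_eq[of l "{x, y, z}"] 
      finite_subset[OF line_subset[OF that(1)] finite_points] by auto
  note ne = dist[unfolded distinct.simps list.set insert_iff empty_iff simp_thms de_Morgan_disj]
  note mem = a(1-3) b(1-3) c(1-3) d(1-3) e(1-3) f(1-3) g(1-3) h(1-3) i(1-3)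
  have T: "T 0 = {a, d, g}" "T 1 = {b, f, i}" "T 2 = {a, e, h}" "T 3 = {c, f, g}"
    "T 4 = {b, d, h}" "T 5 = {c, e, i}"
    by (rule line3, rule TL; simp add: mem ne del: One_nat_def)+
  have once: "\<not> (x \<in> X \<and> y \<in> X)" if "X \<in> M" "x \<in> T k" "y \<in> T k" "x \<noteq> y" "k < 6" for X x y k
    using line_unique[of x y X "T k"] transversal[OF that(1,5)] that sub TL line_subset by blast
  \<comment> \<open>Each side of the prism triangle on 0, 2, 4 forces its matching. Here
    \<open>a\<close> uses up \<open>T 0\<close> and \<open>T 2\<close>, so \<open>T 4\<close> can be
    met only in \<open>b\<close>, and then \<open>T 3\<close> only in \<open>c\<close>; the sides
    \<open>d\<close> and \<open>h\<close> are treated alike.\<close>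
  obtain X where X: "X \<in> M" "a \<in> X" using cover a by blast
  have "b \<in> X" using transversal[OF X(1), of 4] once[OF X(1), of a 0 d] once[OF X(1), of a 2 h] dist X(2) T by auto
  moreover have "c \<in> X" using transversal[OF X(1), of 3] once[OF X(1), of a 0 g] once[OF X(1), of b 1 f] dist X(2) T calculation by auto
  ultimately have X': "{a, b, c} \<in> L" using line3[of X a b c] X sub dist by auto
  obtain Y where Y: "Y \<in> M" "d \<in> Y" using cover d by blast
  have "e \<in> Y" using transversal[OF Y(1), of 2] once[OF Y(1), of d 0 a] once[OF Y(1), of d 4 h] dist Y(2) T by auto
  moreover have "f \<in> Y" using transversal[OF Y(1), of 3] once[OF Y(1), of d 0 g] once[OF Y(1), of e 5 c] dist Y(2) T calculation by auto
  ultimately have Y': "{d, e, f} \<in> L" using line3[of Y d e f] Y sub dist by auto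
  obtain Z where Z: "Z \<in> M" "h \<in> Z" using cover h by blast
  have "g \<in> Z" using transversal[OF Z(1), of 0] once[OF Z(1), of h 2 a] once[OF Z(1), of h 4 d] dist Z(2) T by auto
  moreover have "i \<in> Z" using transversal[OF Z(1), of 1] once[OF Z(1), of h 4 b] once[OF Z(1), of g 3 f] dist Z(2) T calculation by auto
  ultimately have Z': "{g, h, i} \<in> L" using line3[of Z g h i] Z sub dist by auto
  define \<phi> where "\<phi> k = [a, b, c, d, e, f, g, h, i] ! k" for k
  have \<phi>: "\<phi> 0 = a" "\<phi> 1 = b" "\<phi> 2 = c" "\<phi> 3 = d" "\<phi> 4 = e" "\<phi> 5 = f" "\<phi> 6 = g" "\<phi> 7 = h" "\<phi> 8 = i"
    by (simp_all add: \<phi>_def numeral_eq_Suc)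
  have points: "points_9_1 = {..<9}" by (auto simp: points_9_1_def)
  have inj: "inj_on \<phi> points_9_1"
    unfolding points \<phi>_def by (rule inj_on_nth[OF dist]) simp
  have bij: "bij_betw \<phi> points_9_1 P"
  proof -
    have points': "points_9_1 = {0,1,2,3,4,5,6,7,8}" by (auto simp: points_9_1_def)
    have "\<phi> ` points_9_1 \<subseteq> P" unfolding points' by (simp add: \<phi> mem del: One_nat_def)
    moreover have "card (\<phi> ` points_9_1) = card P"
      using card_image[OF inj] card_points by (simp add: points)
    ultimately show ?thesis using inj finite_points by (simp add: bij_betw_def card_subset_eq)
  qed
  have TL': "T 0 \<in> L" "T 1 \<in> L" "T 2 \<in> L" "T 3 \<in> L" "T 4 \<in> L" "T 5 \<in> L" by (rule TL; simp)+
  \<comment> \<open>Inclusion is enough, since \<open>\<phi>\<close> is injective and both sides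
    have nine lines.\<close>
  have "(`) \<phi> ` lines_9_1 \<subseteq> L"
    using X' Y' Z' TL' unfolding lines_9_1_def T
    by (simp add: \<phi> insert_commute del: One_nat_def)
  moreover have "inj_on ((`) \<phi>) lines_9_1"
    by (rule inj_on_subset[OF inj_on_image_Pow[OF inj]]) (auto simp: lines_9_1_def points_9_1_def)
  then have "card ((`) \<phi> ` lines_9_1) = card L"
    using card_lines_9_1 card_lines by (simp add: card_image)
  moreover have "finite L" using card_lines by (intro card_ge_0_finite) simp
  ultimately have "(`) \<phi> ` lines_9_1 = L" by (intro card_subset_eq)
  then have "configuration_iso points_9_1 lines_9_1 P L"
    using bij unfolding configuration_iso_def by blast
  then show ?thesis
    by (rule configuration_iso_sym) (auto simp: lines_9_1_def points_9_1_def)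
qed

section \<open>Configurations of deficiency three\<close>

context symmetric_configuration
begin

lemma finite_lines: "finite L"
  using card_lines three_le by (intro card_ge_0_finite) simp

lemma card_inter_le_one:
  assumes "l \<in> L" "l' \<in> L" "l \<noteq> l'" shows "card (l \<inter> l') \<le> 1"
proof (rule ccontr)
  assume "\<not> card (l \<inter> l') \<le> 1"
  then obtain p q where "p \<in> l \<inter> l'" "q \<in> l \<inter> l'" "p \<noteq> q"
    by (metis card_le_Suc0_iff_eq card.infinite One_nat_def zero_le)
  then show False using line_unique[of p q l l'] line_subset assms by blast
qed

lemma card_inter:
  assumes "l \<in> L" "l' \<in> L"
  shows "card (l \<inter> l') = (if l = l' then r else if l \<inter> l' = {} then 0 else 1)"
proof (cases "l = l' \<or> l \<inter> l' = {}")
  case False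
  have "finite (l \<inter> l')" using line_subset[OF assms(1)] finite_points by (blast intro: finite_subset)
  then have "card (l \<inter> l') \<noteq> 0" using False by simp
  then show ?thesis using False card_inter_le_one[OF assms] by auto
qed (auto simp: card_line assms)

text \<open>Double counting of the pairs of a point on \<open>l\<close> and a line through that
  point.\<close>

lemma sum_card_inter:
  assumes "l \<in> L" shows "(\<Sum>l'\<in>L. card (l \<inter> l')) = r * r"
proof -
  have fin: "finite l" using line_subset[OF assms] finite_points by (rule finite_subset)
  have "(\<Sum>l'\<in>L. card (l \<inter> l')) = (\<Sum>l'\<in>L. \<Sum>p\<in>l. if p \<in> l' then 1 else 0)"
    using fin by (simp add: Int_def flip: sum.inter_filter)
  also have "\<dots> = (\<Sum>p\<in>l. \<Sum>l'\<in>L. if p \<in> l' then 1 else 0)" by (rule sum.swap)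
  also have "\<dots> = (\<Sum>p\<in>l. r)"
    using card_lines_through line_subset[OF assms] finite_lines
    by (intro sum.cong) (auto simp flip: sum.inter_filter)
  finally show ?thesis using card_line[OF assms] by simp
qed

text \<open>Of the \<open>r * r\<close> incidences, \<open>l\<close> itself accounts for
  \<open>r\<close> and every other line meeting it for one. The additive form avoids subtraction of
  naturals.\<close>

lemma card_parallel:
  assumes "l \<in> L" shows "card {l' \<in> L. l \<noteq> l' \<and> l \<inter> l' = {}} + r * r + 1 = v + r"
proof -
  let ?N = "{l' \<in> L. l \<noteq> l' \<and> l \<inter> l' = {}}"
  have "r * r = (\<Sum>l'\<in>L. if l' = l then r else if l \<inter> l' = {} then 0 else 1)"
    unfolding sum_card_inter[OF assms, symmetric] using card_inter[OF assms] by (intro sum.cong) auto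
  also have "\<dots> = r + (\<Sum>l'\<in>L - {l}. if l \<inter> l' = {} then 0 else 1)"
    using assms finite_lines by (subst sum.remove[of _ l]) (auto intro!: sum.cong)
  finally have "r * r = r + (\<Sum>l'\<in>L - {l}. if l \<inter> l' = {} then 0 else 1)" .
  moreover have "card ?N = (\<Sum>l'\<in>L - {l}. if l \<inter> l' = {} then 1 else 0)"
  proof -
    have "?N = {l' \<in> L - {l}. l \<inter> l' = {}}" by auto
    then show ?thesis using finite_lines by (simp flip: sum.inter_filter)
  qed
  moreover have "(\<Sum>l'\<in>L - {l}. if l \<inter> l' = {} then 1 else 0) + (\<Sum>l'\<in>L - {l}. if l \<inter> l' = {} then 0 else 1)
      = (\<Sum>l'\<in>L - {l}. 1 :: nat)"
    unfolding sum.distrib[symmetric] by (rule sum.cong) auto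
  moreover have "(\<Sum>l'\<in>L - {l}. 1 :: nat) + 1 = v"
    using assms finite_lines card_lines three_le by simp
  ultimately show ?thesis by linarith
qed

end

text \<open>Parallelism is moved to the numbers of the lines, because matrices and their row
  permutations are indexed by numbers.\<close>

definition parallel_index :: "(nat \<Rightarrow> 'a set) \<Rightarrow> nat \<Rightarrow> nat \<Rightarrow> bool" where
  "parallel_index el i j \<longleftrightarrow> i \<noteq> j \<and> el i \<inter> el j = {}"

lemma (in symmetric_configuration) card_parallel_index:
  assumes el: "bij_betw el I L" and i: "i \<in> I"
  shows "card {j \<in> I. parallel_index el i j} + r * r + 1 = v + r"
proof -
  have L: "L = el ` I" and inj: "inj_on el I" using el by (auto simp: bij_betw_def)
  have "card {j \<in> I. parallel_index el i j} = card (el ` {j \<in> I. parallel_index el i j})"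
    by (rule card_image[symmetric], rule inj_on_subset[OF inj]) blast
  also have "el ` {j \<in> I. parallel_index el i j} = {l \<in> L. el i \<noteq> l \<and> el i \<inter> l = {}}"
    unfolding L using inj_on_eq_iff[OF inj i] by (auto simp: parallel_index_def)
  finally show ?thesis using card_parallel[of "el i"] L i by simp
qed

text \<open>Fixes a numbering of the lines and a decomposition of the indices into cycles, so that
  \<open>m\<close> becomes \<open>length css\<close>.\<close>

locale deficiency_three = symmetric_configuration P L "n\<^sup>2 + n + 3" "n + 1"
  for P :: "'a set" and L :: "'a set set" and n :: nat +
  fixes el :: "nat \<Rightarrow> 'a set" and css :: "nat list list"
  assumes el: "bij_betw el {0..<n\<^sup>2 + n + 3} L"
    and css: "distinct (concat css)" "set (concat css) = {0..<n\<^sup>2 + n + 3}"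
      "\<forall>cs \<in> set css. is_cycle (parallel_index el) {0..<n\<^sup>2 + n + 3} cs"
begin

abbreviation "V \<equiv> {0..<n\<^sup>2 + n + 3}"

lemma cycle_length: "cs \<in> set css \<Longrightarrow> 3 \<le> length cs"
  using css(3) by (simp add: is_cycle_def)

lemma sum_lengths: "sum_list (map length css) = n\<^sup>2 + n + 3"
  using distinct_card[OF css(1)] css(2) by (simp add: length_concat)

lemma el_in: "i \<in> V \<Longrightarrow> el i \<in> L"
  using el by (auto simp: bij_betw_def)

lemma el_eq_iff: "i \<in> V \<Longrightarrow> j \<in> V \<Longrightarrow> el i = el j \<longleftrightarrow> i = j"
  using el by (auto simp: bij_betw_def inj_on_eq_iff)

lemma card_el_inter:
  "i \<in> V \<Longrightarrow> j \<in> V \<Longrightarrow>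
    card (el i \<inter> el j) = (if j = i then n + 1 else if parallel_index el i j then 0 else 1)"
  using card_inter[OF el_in el_in, of i j] by (auto simp: el_eq_iff parallel_index_def)

lemma parallel_index_iff:
  "i \<in> V \<Longrightarrow> j \<in> V \<Longrightarrow>
    parallel_index el i j \<longleftrightarrow> j = cycles_perm css i \<or> i = cycles_perm css j"
  by (rule is_cycle_adj_iff[OF css])

text \<open>The images of the cycles under \<open>el\<close> are the components of the parallel
  graph, so the count does not depend on the chosen decomposition.\<close>

lemma card_parallel_cycles: "card (parallel_cycles L) = length css"
proof -
  let ?G = "with_proj (parallel_graph L)"
  have arc: "l \<rightarrow>\<^bsub>?G\<^esub> l' \<longleftrightarrow> l \<in> L \<and> l' \<in> L \<and> l \<noteq> l' \<and> l \<inter> l' = {}" for l l'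
    by (auto simp: parallel_graph_def arcs_ends_def arc_to_ends_def)
  have "card (pre_digraph.sccs ?G) = length (map (map el) css)"
  proof (rule card_sccs_sym_digraph)
    show "sym_digraph ?G"
    proof
      show "symmetric ?G" unfolding symmetric_def sym_def using arc by blast
    qed (auto simp: parallel_graph_def)
    have "set (concat (map (map el) css)) = el ` V" unfolding css(2)[symmetric] by auto
    also have "\<dots> = L" using el by (simp add: bij_betw_def)
    finally show "set (concat (map (map el) css)) = verts ?G" by (simp add: parallel_graph_def)
    show "distinct (concat (map (map el) css))"
      using css el by (simp add: distinct_map bij_betw_def flip: map_concat)
    show "[] \<notin> set (map (map el) css)" using cycle_length by fastforce
  next
    fix ds i assume "ds \<in> set (map (map el) css)" "Suc i < length ds"
    then obtain cs where cs: "cs \<in> set css" "ds = map el cs" "Suc i < length cs" by auto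
    then have "cs ! Suc i \<in> {y \<in> V. parallel_index el (cs ! i) y}" and V: "set cs \<subseteq> V"
      using css(3) unfolding is_cycle_def by auto
    moreover from V have "cs ! i \<in> V" "cs ! Suc i \<in> V" using cs nth_mem Suc_lessD by blast+
    ultimately show "ds ! i \<rightarrow>\<^bsub>?G\<^esub> ds ! Suc i"
      unfolding arc using cs by (simp add: el_in el_eq_iff parallel_index_def)
  next
    fix ds x y assume "ds \<in> set (map (map el) css)" "x \<in> set ds" and xy: "x \<rightarrow>\<^bsub>?G\<^esub> y"
    then obtain cs i where cs: "cs \<in> set css" "ds = map el cs" "i \<in> set cs" "x = el i" by auto
    have "y \<in> L" using xy unfolding arc by blast
    then obtain j where j: "j \<in> V" "y = el j" using el by (auto simp: bij_betw_def)
    have "parallel_index el i j" using xy j cs unfolding arc parallel_index_def by auto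
    moreover have "is_cycle (parallel_index el) V cs" using css(3) cs(1) by blast
    ultimately have "j \<in> set cs" using is_cycle_closed[OF _ cs(3) j(1)] by blast
    then show "y \<in> set ds" using cs j by simp
  qed
  then show ?thesis by (simp add: parallel_cycles_def)
qed

lemma odd_length_of_three_le:
  assumes n: "3 \<le> n" shows "odd (length css)"
proof -
  let ?v = "n\<^sup>2 + n + 3" and ?s = "cycles_perm css"
  obtain ep where ep: "bij_betw ep {0..<?v} P"
    using ex_bij_betw_nat_finite[OF finite_points] card_points by auto
  define M where "M = mat ?v ?v (\<lambda>(i, j). if ep j \<in> el i then 1 else 0 :: real)"
  have "sign ?s = 1"
  proof (rule gram_sign[OF n refl, where A = M])
    show s: "?s permutes {0..<?v}" using cycles_perm_permutes[of css] css(2) by simp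
    have len: "\<forall>cs \<in> set css. 3 \<le> length cs" using cycle_length by blast
    show "?s i \<noteq> i" "?s (?s i) \<noteq> i" if "i < ?v" for i
      using cycles_perm_moves[OF css(1) len, unfolded css(2), of i] that by simp_all
    show "M \<in> carrier_mat ?v ?v" by (simp add: M_def)
    show "M $$ (i, j) \<in> \<rat>" if "i < ?v" "j < ?v" for i j using that by (simp add: M_def)
    fix i j assume ij: "i < ?v" "j < ?v"
    \<comment> \<open>With \<open>M\<close> the incidence matrix, the inner product of two rows
      counts the common points of the two lines.\<close>
    have "(\<Sum>k<?v. M $$ (i, k) * M $$ (j, k)) = (\<Sum>k<?v. if ep k \<in> el i \<inter> el j then 1 else 0)"
      using ij by (intro sum.cong) (auto simp: M_def)
    also have "\<dots> = (\<Sum>p\<in>P. if p \<in> el i \<inter> el j then 1 else 0)"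
      using sum.reindex_bij_betw[OF ep, of "\<lambda>p. if p \<in> el i \<inter> el j then 1 else 0 :: real"]
      by (simp add: atLeast0LessThan)
    also have "\<dots> = card {p \<in> P. p \<in> el i \<inter> el j}"
      using finite_points by (simp flip: sum.inter_filter)
    also have "{p \<in> P. p \<in> el i \<inter> el j} = el i \<inter> el j" using line_subset el_in ij by auto
    also have "card (el i \<inter> el j) = (if j = i then n + 1 else if j = ?s i \<or> i = ?s j then 0 else 1)"
      using card_el_inter[of i j] parallel_index_iff[of i j] ij by simp
    finally show "(\<Sum>k<?v. M $$ (i, k) * M $$ (j, k)) =
      real (if j = i then n + 1 else if j = ?s i \<or> i = ?s j then 0 else 1)" .
  qed
  moreover have "[] \<notin> set css" using cycle_length by fastforce
  moreover have "length (concat css) = ?v" using distinct_card[OF css(1)] css(2) by simp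
  ultimately have "(- 1 :: int) ^ (?v + length css) = 1"
    using sign_cycles_perm[OF css(1)] by simp
  then have "even (?v + length css)" by (metis neg_one_odd_power one_neq_neg_one)
  moreover have "odd ?v" by simp
  ultimately show ?thesis by simp
qed

lemma odd_length_of_one:
  assumes "n = 1" shows "odd (length css)"
proof -
  have "3 * length css \<le> sum_list (map length css)"
    using sum_list_mono[of css "\<lambda>_. 3" length] cycle_length by (simp add: sum_list_triv)
  then have "length css \<le> 1" "css \<noteq> []" using sum_lengths assms by auto
  then have "length css = 1" by (cases css) auto
  then show ?thesis by simp
qed

text \<open>For \<open>n = 2\<close> the number of lines of a cycle through a point has variance \<open>0\<close>.\<close>

lemma cycle_regular:
  assumes n: "n = 2" and cs: "cs \<in> set css" and p: "p \<in> P"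
  shows "3 * card {i \<in> set cs. p \<in> el i} = length cs"
proof -
  define c where "c = length cs"
  define a where "a p = card {i \<in> set cs. p \<in> el i}" for p
  have cyc: "is_cycle (parallel_index el) V cs" using css(3) cs by blast
  then have V: "set cs \<subseteq> V" and c: "3 \<le> c" and card: "card (set cs) = c"
    by (auto simp: is_cycle_def c_def distinct_card)
  have deg: "card {j \<in> set cs. parallel_index el i j} = 2" if "i \<in> set cs" for i
  proof -
    have "card {j \<in> V. parallel_index el i j} = 2"
      using card_parallel_index[OF el, of i] V that n by auto
    moreover have "{j \<in> V. parallel_index el i j} = {j \<in> set cs. parallel_index el i j}"
      using is_cycle_closed[OF cyc that] V by blast
    ultimately show ?thesis by simp
  qed
  \<comment> \<open>A line of the cycle shares 3 points with itself, none with its two neighbours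
    and one with each of the other \<open>c - 3\<close> lines.\<close>
  have sq: "(\<Sum>j\<in>set cs. card (el i \<inter> el j)) = c" if i: "i \<in> set cs" for i
  proof -
    have "(\<Sum>j\<in>set cs. card (el i \<inter> el j)) + card {j \<in> set cs. parallel_index el i j} =
        (\<Sum>j\<in>set cs. card (el i \<inter> el j) + (if parallel_index el i j then 1 else 0))"
      by (simp add: sum.distrib flip: sum.inter_filter)
    also have "\<dots> = (\<Sum>j\<in>set cs. 1 + (if j = i then 2 else 0))"
      using V i n by (intro sum.cong) (auto simp: card_el_inter subset_iff parallel_index_def)
    also have "\<dots> = c + 2" unfolding sum.distrib using i card by simp
    finally show ?thesis using deg[OF i] by simp
  qed
  have a_sum: "int (a p) = (\<Sum>i\<in>set cs. if p \<in> el i then 1 else 0)" for p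
    unfolding a_def by (simp flip: sum.inter_filter)
  have swap: "(\<Sum>p\<in>P. if p \<in> el i \<inter> el j then 1 else 0) = int (card (el i \<inter> el j))" if "i \<in> set cs" for i j
  proof -
    have "{p \<in> P. p \<in> el i \<inter> el j} = el i \<inter> el j" using line_subset[OF el_in[of i]] V that by blast
    then show ?thesis using finite_points by (simp flip: sum.inter_filter)
  qed
  have "(\<Sum>p\<in>P. int (a p)) = (\<Sum>i\<in>set cs. \<Sum>p\<in>P. if p \<in> el i \<inter> el i then 1 else 0)"
    unfolding a_sum by (subst sum.swap) simp
  also have "\<dots> = (\<Sum>i\<in>set cs. 3)"
    using V n card_el_inter by (intro sum.cong refl) (auto simp only: swap subset_iff, simp)
  finally have S1: "(\<Sum>p\<in>P. int (a p)) = 3 * int c" using card by simp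
  have "(\<Sum>p\<in>P. int (a p) * int (a p)) =
      (\<Sum>p\<in>P. \<Sum>i\<in>set cs. \<Sum>j\<in>set cs. if p \<in> el i \<inter> el j then 1 else 0)"
    unfolding a_sum sum_product by (intro sum.cong) auto
  also have "\<dots> = (\<Sum>i\<in>set cs. \<Sum>j\<in>set cs. \<Sum>p\<in>P. if p \<in> el i \<inter> el j then 1 else 0)"
    by (subst sum.swap) (intro sum.cong sum.swap refl)
  also have "\<dots> = (\<Sum>i\<in>set cs. int (\<Sum>j\<in>set cs. card (el i \<inter> el j)))"
    by (simp add: swap del: Int_iff)
  also have "\<dots> = int c * int c" using sq card by simp
  finally have S2: "(\<Sum>p\<in>P. int (a p) * int (a p)) = int c * int c" .
  \<comment> \<open>The mean of \<open>a\<close> over the nine points is \<open>c / 3\<close>. The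
    sum of squares becomes \<open>9 c c - 18 c c + 9 c c = 0\<close>.\<close>
  have "(\<Sum>p\<in>P. (3 * int (a p) - int c)\<^sup>2) =
      (\<Sum>p\<in>P. 9 * (int (a p) * int (a p)) - (6 * int c) * int (a p) + int c * int c)"
    by (intro sum.cong) (auto simp: power2_eq_square algebra_simps)
  also have "\<dots> = 0"
    using card_points n unfolding sum.distrib sum_subtractf sum_distrib_left[symmetric] S1 S2 by simp
  finally have "\<forall>p\<in>P. (3 * int (a p) - int c)\<^sup>2 = 0"
    using sum_nonneg_eq_0_iff[OF finite_points, of "\<lambda>p. (3 * int (a p) - int c)\<^sup>2"] by simp
  then have "3 * int (a p) = int c" using p by simp
  then show ?thesis unfolding a_def c_def by linarith
qed

lemma iso_9_1_of_two:
  assumes n: "n = 2" and even: "even (length css)"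
  shows "configuration_iso P L points_9_1 lines_9_1"
proof -
  have V9: "V = {0..<9}" and v9: "n\<^sup>2 + n + 3 = 9" using n by simp_all
  have dvd: "3 dvd length cs" if "cs \<in> set css" for cs
  proof -
    have "P \<noteq> {}" using card_points by auto
    then show ?thesis using cycle_regular[OF n that] by (metis dvd_triv_left ex_in_conv)
  qed
  have "3 * length css \<le> sum_list (map length css)"
    using sum_list_mono[of css "\<lambda>_. 3" length] cycle_length by (simp add: sum_list_triv)
  then have "length css \<le> 3" "css \<noteq> []" using sum_lengths n by auto
  then have "length css \<le> 3" "length css \<noteq> 0" by simp_all
  \<comment> \<open>Nine lines in cycles of length at least 3 give at most three cycles; 2 is the
    only even positive choice.\<close>
  then have "length css = 2" using even by presburger
  then obtain xs ys where xy: "css = [xs, ys]" by (auto simp: length_Suc_conv numeral_2_eq_2)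
  have "length xs + length ys = 9" using sum_lengths v9 xy by simp
  moreover have "3 dvd length xs" "3 \<le> length xs" "3 \<le> length ys" using dvd cycle_length xy by auto
  ultimately have lens: "length xs = 3 \<and> length ys = 6 \<or> length xs = 6 \<and> length ys = 3" by presburger
  then obtain as bs where ab: "as \<in> set css" "bs \<in> set css" "length as = 3" "length bs = 6"
    "set as \<union> set bs = V" "set as \<inter> set bs = {}"
  proof -
    have "set xs \<union> set ys = V" "set xs \<inter> set ys = {}" using xy css(1,2) by simp_all
    then show ?thesis
      using lens that[of xs ys] that[of ys xs] xy by (metis Int_commute Un_commute list.set_intros)
  qed
  have cyc: "is_cycle (parallel_index el) V bs" using css(3) ab by blast
  then have dist: "distinct bs" and bsV: "set bs \<subseteq> V" by (auto simp: is_cycle_def)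
  have asV: "set as \<subseteq> V" using ab by blast
  have bV: "bs ! k \<in> V" if "k < 6" for k
    by (rule subsetD[OF bsV nth_mem]) (simp add: ab(4) that)
  show ?thesis
  proof (rule hexagon_triangle_iso_9_1[where T = "\<lambda>k. el (bs ! k)" and M = "el ` set as"])
    show "symmetric_configuration P L 9 3"
      using symmetric_configuration_axioms n by simp
    show "el (bs ! k) \<in> L" if "k < 6" for k using el_in bV that by blast
    show "el ` set as \<subseteq> L" using el_in asV by blast
    show "el (bs ! i) \<inter> el (bs ! j) \<noteq> {}"
      if ij: "i < 6" "j < 6" "j \<noteq> i" "j \<noteq> Suc i mod 6" "i \<noteq> Suc j mod 6" for i j
    proof
      assume "el (bs ! i) \<inter> el (bs ! j) = {}"
      then have mem: "bs ! j \<in> {y \<in> V. parallel_index el (bs ! i) y}"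
        using ij bV dist ab(4) by (auto simp: parallel_index_def nth_eq_iff_index_eq)
      have "bs ! j = bs ! (Suc i mod 6) \<or> bs ! j = bs ! ((i + 5) mod 6)"
      proof -
        have "{y \<in> V. parallel_index el (bs ! i) y} = {bs ! (Suc i mod 6), bs ! ((i + 6 - 1) mod 6)}"
          using cyc ij(1) unfolding is_cycle_def ab(4) by blast
        moreover have "i + 6 - 1 = i + 5" by simp
        ultimately show ?thesis using mem by (simp only: insert_iff empty_iff simp_thms)
      qed
      then have "j = Suc i mod 6 \<or> j = (i + 5) mod 6"
        using nth_eq_iff_index_eq[OF dist, of j] ij(2) ab(4) by simp
      \<comment> \<open>If \<open>j\<close> precedes \<open>i\<close> on the hexagon, then
        \<open>i\<close> succeeds \<open>j\<close>, which the last assumption on \<open>i\<close>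
        and \<open>j\<close> excludes.\<close>
      then have "j = (i + 5) mod 6" using ij(4) by blast
      then have "Suc j mod 6 = Suc (i + 5) mod 6" by (simp only: mod_Suc_eq)
      also have "\<dots> = i" using ij(1) by simp
      finally show False using ij(5) by simp
    qed
    \<comment> \<open>Regularity of the hexagon: \<open>6 / 3 = 2\<close> of its lines pass through
      each point.\<close>
    show "card {k. k < 6 \<and> p \<in> el (bs ! k)} = 2" if "p \<in> P" for p
    proof -
      have "bij_betw ((!) bs) {k. k < 6 \<and> p \<in> el (bs ! k)} {i \<in> set bs. p \<in> el i}"
        using dist ab(4) unfolding bij_betw_def
        by (auto simp: inj_on_def nth_eq_iff_index_eq in_set_conv_nth image_iff)
      then show ?thesis using cycle_regular[OF n ab(2) that] ab(4) by (simp add: bij_betw_same_card)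
    qed
    show "X \<noteq> el (bs ! k) \<and> X \<inter> el (bs ! k) \<noteq> {}" if X: "X \<in> el ` set as" and k: "k < 6" for X k
    proof -
      obtain i where i: "i \<in> set as" "X = el i" using X by blast
      have b: "bs ! k \<in> set bs" using k ab(4) by simp
      have ne: "i \<noteq> bs ! k" using i(1) b ab(6) by blast
      have "i \<in> V" using i(1) asV by blast
      \<comment> \<open>Parallel lines lie in the same cycle, so a triangle line meets every hexagon
        line.\<close>
      then have "\<not> parallel_index el (bs ! k) i"
        using is_cycle_closed[OF cyc b] i(1) ab(6) by blast
      then show ?thesis using ne i(2) \<open>i \<in> V\<close> bV[OF k] el_eq_iff[of i "bs ! k"] by (auto simp: parallel_index_def)
    qed
    show "\<exists>X\<in>el ` set as. p \<in> X" if "p \<in> P" for p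
    proof -
      \<comment> \<open>Regularity of the triangle: \<open>3 / 3 = 1\<close> of its lines passes
        through each point.\<close>
      have "card {i \<in> set as. p \<in> el i} \<noteq> 0" using cycle_regular[OF n ab(1) that] ab(3) by simp
      then have "{i \<in> set as. p \<in> el i} \<noteq> {}" by fastforce
      then show ?thesis by blast
    qed
  qed
qed

end

theorem theorem6p1:
  fixes n m :: nat and P :: "'a set" and L :: "'a set set"
  assumes "n \<ge> 1"
    and "symmetric_configuration P L (n^2 + n + 3) (n + 1)"
    and "m = card (parallel_cycles L)"
  shows "configuration_iso P L points_9_1 lines_9_1 \<or> odd m"
proof -
  interpret symmetric_configuration P L "n^2 + n + 3" "n + 1" by fact
  let ?V = "{0..<n^2 + n + 3}"
  obtain el where el: "bij_betw el ?V L"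
    using ex_bij_betw_nat_finite[OF finite_lines] card_lines by auto
  \<comment> \<open>For deficiency 3, \<open>v + r - r * r - 1\<close> equals 2 with
    \<open>r = n + 1\<close>.\<close>
  have deg: "card {j \<in> ?V. parallel_index el i j} = 2" if "i \<in> ?V" for i
    using card_parallel_index[OF el that] by (simp add: power2_eq_square)
  obtain css where css: "distinct (concat css)" "set (concat css) = ?V"
    "\<forall>cs \<in> set css. is_cycle (parallel_index el) ?V cs"
    using two_regular_cycle_partition[of ?V "parallel_index el"] deg
    by (auto simp: parallel_index_def)
  interpret deficiency_three P L n el css
    by unfold_locales (fact el css)+
  have "m = length css" using assms(3) card_parallel_cycles by simp
  moreover have "n = 1 \<or> n = 2 \<or> 3 \<le> n" using assms(1) by linarith
  ultimately show ?thesis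
    using odd_length_of_one odd_length_of_three_le iso_9_1_of_two by blast
qed

end
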